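(* $\widehat{\mathcal O}_\theta$ is a topological field (for the inframetric topology) containing $K$, i.e. the embedding $\mathcal O_K\hookrightarrow\widehat{\mathcal O}_\theta$ extends to an embedding of the field $K$.
   Context: $\theta>1$ is a real quadratic unit with $N(\theta)=-1$, so $\theta^2=a\theta+1$ with an integer $a\ge1$; $K=\mathbb Q(\theta)\subset\mathbb R$, $\mathcal O_K$ its ring of integers. A greedy polynomial is a finite sum $\sum_{i=m}^M b_i\theta^i$ with $b_i\in\{0,\dots,a\}$ such that $b_i=a$ implies $b_{i-1}=0$; every nonzero $\alpha\in\mathcal O_K$ is uniquely $\pm$ such a sum with $b_m\ne0$, and $|\alpha|_\theta:=\theta^{-m}$, $|0|_\theta=0$. $\widehat{\mathcal O}_\theta=\mathcal R_\theta/\mathcal M_\theta$, where $\mathcal R_\theta$ is the ring (componentwise operations) of sequences in $\mathcal O_K$ Cauchy for $|\cdot|_\theta$ and $\mathcal M_\theta$ the ideal of those with $|f_n|_\theta\to0$; $\mathcal O_K$ embeds via constant sequences. For $\hat h\in\widehat{\mathcal O}_\theta$ put $|\hat h|_\theta:=\max_{(h_i)\in\hat h}\limsup_i|h_i|_\theta$ (maximum over representing sequences). The inframetric topology on $\widehat{\mathcal O}_\theta$ is the unique topology in which, for each $\hat f$, the sets $\{\hat g:|\hat f-\hat g|_\theta<\varepsilon\}$, $\varepsilon>0$, form a base of the neighbourhood filter of $\hat f$.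
   Formalization: It is assumed that every nonzero element of O_K is ± a greedy polynomial; this fails for some θ (for θ=2+√5, (1+√5)/2 lies in O_K but not in Z[θ]), and then |·|_θ is undefined on O_K. *)

theory Defs
  imports
    "HOL-Analysis.Analysis"
    "HOL-Algebra.QuotRing"
    "HOL-Algebra.Generated_Fields"
    "HOL-Algebra.Algebraic_Closure_Type"
begin

section \<open>The field and its ring of integers\<close>

abbreviation real_ring :: "real ring" where
  "real_ring \<equiv> ring_of_type_algebra"

definition number_field :: "real \<Rightarrow> real set" where
  "number_field \<theta> = generate_field real_ring {\<theta>}"

definition integer_ring :: "real \<Rightarrow> real set" where
  "integer_ring \<theta> = {x \<in> number_field \<theta>. algebraic_int x}"

section \<open>Greedy polynomials and the inframetric absolute value\<close>

text \<open>
  Coefficients outside \<open>{m..M}\<close> are set to zero, so at the lowest position \<open>m\<close> the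
  condition on \<open>b (m - 1)\<close> holds automatically. Exponents may be negative.
\<close>

definition greedy_coeffs :: "int \<Rightarrow> int \<Rightarrow> int \<Rightarrow> (int \<Rightarrow> int) \<Rightarrow> bool" where
  "greedy_coeffs a m M b \<longleftrightarrow>
     m \<le> M \<and> (\<forall>i. i \<notin> {m..M} \<longrightarrow> b i = 0) \<and>
     (\<forall>i. b i \<in> {0..a}) \<and> (\<forall>i. b i = a \<longrightarrow> b (i - 1) = 0)"

definition greedy_sum :: "real \<Rightarrow> int \<Rightarrow> int \<Rightarrow> (int \<Rightarrow> int) \<Rightarrow> real" where
  "greedy_sum \<theta> m M b = (\<Sum>i\<in>{m..M}. of_int (b i) * \<theta> powi i)"

definition greedy_order :: "real \<Rightarrow> int \<Rightarrow> real \<Rightarrow> int \<Rightarrow> bool" where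
  "greedy_order \<theta> a \<alpha> m \<longleftrightarrow>
     (\<exists>M b. greedy_coeffs a m M b \<and> b m \<noteq> 0 \<and>
        (\<alpha> = greedy_sum \<theta> m M b \<or> \<alpha> = - greedy_sum \<theta> m M b))"

text \<open>
  The value is meaningful only for \<open>\<alpha> = 0\<close> and for \<open>\<alpha>\<close> with a finite signed greedy
  expansion. If \<open>integer_ring \<theta>\<close> is larger than \<open>\<int>[\<theta>]\<close> (as for \<open>\<theta> = 2 + sqrt 5\<close>), some
  integers have none, so existence of expansions has to be assumed where it is needed.
\<close>

definition theta_abs :: "real \<Rightarrow> int \<Rightarrow> real \<Rightarrow> real" where
  "theta_abs \<theta> a \<alpha> = (if \<alpha> = 0 then 0 else \<theta> powi (- (THE m. greedy_order \<theta> a \<alpha> m)))"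

section \<open>The completion\<close>

definition theta_cauchy :: "real \<Rightarrow> int \<Rightarrow> (nat \<Rightarrow> real) \<Rightarrow> bool" where
  "theta_cauchy \<theta> a f \<longleftrightarrow>
     (\<forall>\<epsilon>>0. \<exists>N. \<forall>i\<ge>N. \<forall>j\<ge>N. theta_abs \<theta> a (f i - f j) < \<epsilon>)"

definition cauchy_ring :: "real \<Rightarrow> int \<Rightarrow> (nat \<Rightarrow> real) ring" where
  "cauchy_ring \<theta> a =
     \<lparr>carrier = {f. (\<forall>n. f n \<in> integer_ring \<theta>) \<and> theta_cauchy \<theta> a f},
      mult = (\<lambda>f g n. f n * g n), one = (\<lambda>_. 1), zero = (\<lambda>_. 0), add = (\<lambda>f g n. f n + g n)\<rparr>"

definition null_ideal :: "real \<Rightarrow> int \<Rightarrow> (nat \<Rightarrow> real) set" where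
  "null_ideal \<theta> a =
     {f \<in> carrier (cauchy_ring \<theta> a). (\<lambda>n. theta_abs \<theta> a (f n)) \<longlonglongrightarrow> 0}"

definition theta_completion :: "real \<Rightarrow> int \<Rightarrow> (nat \<Rightarrow> real) set ring" where
  "theta_completion \<theta> a = cauchy_ring \<theta> a Quot null_ideal \<theta> a"

definition completion_embedding :: "real \<Rightarrow> int \<Rightarrow> real \<Rightarrow> (nat \<Rightarrow> real) set" where
  "completion_embedding \<theta> a \<alpha> = null_ideal \<theta> a +>\<^bsub>cauchy_ring \<theta> a\<^esub> (\<lambda>_. \<alpha>)"

text \<open>
  An element of the completion is a coset, that is, the set of its representing sequences.
  \<open>GREATEST\<close> is the maximum of a possibly infinite set (\<open>Max\<close> is only meaningful for finite ones).
\<close>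

definition completion_abs :: "real \<Rightarrow> int \<Rightarrow> (nat \<Rightarrow> real) set \<Rightarrow> ereal" where
  "completion_abs \<theta> a F =
     (GREATEST r. \<exists>h\<in>F. r = limsup (\<lambda>i. ereal (theta_abs \<theta> a (h i))))"

definition completion_ball ::
    "real \<Rightarrow> int \<Rightarrow> (nat \<Rightarrow> real) set \<Rightarrow> real \<Rightarrow> (nat \<Rightarrow> real) set set" where
  "completion_ball \<theta> a F \<epsilon> =
     {G \<in> carrier (theta_completion \<theta> a).
        completion_abs \<theta> a (F \<ominus>\<^bsub>theta_completion \<theta> a\<^esub> G) < ereal \<epsilon>}"

text \<open>
  The balls need not be open. The second clause says that they form a base of the neighbourhood
  filter: a set is a neighbourhood of \<open>F\<close> iff it contains a ball around \<open>F\<close>.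
\<close>

definition is_inframetric_topology :: "real \<Rightarrow> int \<Rightarrow> (nat \<Rightarrow> real) set topology \<Rightarrow> bool" where
  "is_inframetric_topology \<theta> a T \<longleftrightarrow>
     topspace T = carrier (theta_completion \<theta> a) \<and>
     (\<forall>F\<in>carrier (theta_completion \<theta> a). \<forall>P.
        eventually P (nhdsin T F) \<longleftrightarrow> (\<exists>\<epsilon>>0. \<forall>G\<in>completion_ball \<theta> a F \<epsilon>. P G))"

definition inframetric_topology :: "real \<Rightarrow> int \<Rightarrow> (nat \<Rightarrow> real) set topology" where
  "inframetric_topology \<theta> a = (THE T. is_inframetric_topology \<theta> a T)"

section \<open>Topological fields\<close>

definition topological_field :: "('a, 'b) ring_scheme \<Rightarrow> 'a topology \<Rightarrow> bool" where
  "topological_field F T \<longleftrightarrow>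
     field F \<and> topspace T = carrier F \<and>
     continuous_map (prod_topology T T) T (\<lambda>(x, y). x \<oplus>\<^bsub>F\<^esub> y) \<and>
     continuous_map T T (\<lambda>x. \<ominus>\<^bsub>F\<^esub> x) \<and>
     continuous_map (prod_topology T T) T (\<lambda>(x, y). x \<otimes>\<^bsub>F\<^esub> y) \<and>
     continuous_map (subtopology T (carrier F - {\<zero>\<^bsub>F\<^esub>})) T (\<lambda>x. inv\<^bsub>F\<^esub> x)"

end

theory Submission
  imports Defs
begin

text \<open>
  Conjugation sends \<open>\<theta>\<close> to \<open>\<tau> = - 1 / \<theta>\<close>, so in the conjugate of a greedy polynomial the lowest
  term dominates; the greedy condition sharpens this to
  \<open>\<bar>\<alpha>\<bar>\<^sub>\<theta> / \<theta> \<le> \<bar>\<alpha>'\<bar> \<le> \<theta> * \<bar>\<alpha>\<bar>\<^sub>\<theta>\<close>. Hence a sequence is Cauchy (null) for the inframetric iff its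
  conjugates form a Cauchy (null) sequence of reals, and the limit of the conjugates identifies the
  completion with the field of real numbers, topology included. Under this identification \<open>K\<close>
  embeds by conjugation.
\<close>

section \<open>Greedy digits and their conjugates\<close>

text \<open>The powers of \<open>\<tau>\<close> alternate in sign, so in a conjugate the terms at
  odd distance from the lowest one work against it. A lowest digit 1 followed by the digits
  \<open>a, 0, a, 0, ...\<close> would be cancelled completely in the limit, since
  \<open>a/\<theta> + a/\<theta>^3 + ... = 1\<close>. The greedy condition forbids exactly this:
  above a nonzero digit the next one is at most \<open>a - 1\<close>, and what is left over is at
  least \<open>1/\<theta>\<close>. The comparison loses a factor \<open>\<theta>\<close> in each
  direction, so no triangle inequality for \<open>theta_abs\<close> is available for the usual
  theory of completions; ring structure, inverses and neighbourhoods are all transported from the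
  reals. Inverses in particular exist although few integers are invertible: the conjugates of the
  integers are dense in the reals, so \<open>1/x\<close> is a limit of conjugates whenever
  \<open>x\<close> is a nonzero one. The maximum that defines \<open>completion_abs\<close> needs an
  argument of its own. It is attained because the nonzero values of \<open>theta_abs\<close> are
  powers of \<open>\<theta>\<close>, only finitely many of which lie between two positive
  bounds.\<close>

definition greedy_digits :: "int \<Rightarrow> (nat \<Rightarrow> int) \<Rightarrow> bool" where
  "greedy_digits a c \<longleftrightarrow> (\<forall>j. 0 \<le> c j \<and> c j \<le> a \<and> (c (Suc j) = a \<longrightarrow> c j = 0))"

lemma greedy_digits_shift: "greedy_digits a c \<Longrightarrow> greedy_digits a (\<lambda>j. c (Suc j))"
  by (auto simp: greedy_digits_def)

text \<open>The starting exponent \<open>l\<close> is free, so that expansions with different lowest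
  exponents can be read as digit strings over one common range.\<close>

lemma greedy_coeffs_digits:
  assumes "greedy_coeffs a m M b"
  shows "greedy_digits a (\<lambda>j. b (l + int j))"
proof -
  have "b (l + int (Suc j)) = a \<longrightarrow> b (l + int (Suc j) - 1) = 0" for j
    using assms unfolding greedy_coeffs_def by blast
  then show ?thesis
    using assms unfolding greedy_coeffs_def greedy_digits_def by (auto simp: algebra_simps)
qed

lemma sum_powi_shift:
  fixes x :: "'a :: field"
  assumes "x \<noteq> 0"
  shows "(\<Sum>i\<in>{l..<l + int n}. of_int (b i) * x powi i) =
    x powi l * (\<Sum>j<n. of_int (b (l + int j)) * x ^ j)"
proof -
  have "(\<Sum>i\<in>{l..<l + int n}. of_int (b i) * x powi i) =
      (\<Sum>j<n. of_int (b (l + int j)) * x powi (l + int j))"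
    by (rule sum.reindex_bij_witness[of _ "\<lambda>j. l + int j" "\<lambda>i. nat (i - l)"]) auto
  also have "\<dots> = x powi l * (\<Sum>j<n. of_int (b (l + int j)) * x ^ j)"
    using assms by (simp add: sum_distrib_left power_int_add algebra_simps)
  finally show ?thesis .
qed

lemma greedy_sum_widen:
  assumes "greedy_coeffs a m M b" "l \<le> m" "M < l + int n" "x \<noteq> 0"
  shows "greedy_sum x m M b = x powi l * (\<Sum>j<n. of_int (b (l + int j)) * x ^ j)"
proof -
  have "greedy_sum x m M b = (\<Sum>i\<in>{l..<l + int n}. of_int (b i) * x powi i)"
    unfolding greedy_sum_def using assms(1-3)
    by (intro sum.mono_neutral_left) (auto simp: greedy_coeffs_def)
  then show ?thesis using sum_powi_shift[OF assms(4)] by metis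
qed

locale quadratic_unit =
  fixes \<theta> :: real and a :: int
  assumes gt_1: "\<theta> > 1" and irrational: "\<theta> \<notin> \<rat>"
    and a_ge_1: "a \<ge> 1" and square: "\<theta>\<^sup>2 = of_int a * \<theta> + 1"
begin

text \<open>Written through the trace \<open>a\<close>, which puts it visibly into the span of 1 and
  \<open>\<theta>\<close>; the form \<open>- inverse \<theta>\<close> used in estimates then follows
  from the norm being -1.\<close>

definition \<tau> :: real where "\<tau> = of_int a - \<theta>"

lemma theta_mult_tau: "\<theta> * \<tau> = -1"
  using square by (simp add: \<tau>_def power2_eq_square algebra_simps)

lemma tau_eq: "\<tau> = - inverse \<theta>"
  using theta_mult_tau gt_1 by (simp add: field_simps)

lemma tau_irrational: "\<tau> \<notin> \<rat>"
  using irrational by (metis \<tau>_def Rats_diff Rats_of_int diff_diff_eq2 add_diff_cancel_left')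

lemma tau_square: "\<tau> * \<tau> = of_int a * \<tau> + 1"
  using theta_mult_tau by (simp add: \<tau>_def algebra_simps)

lemma tau_nonzero: "\<tau> \<noteq> 0"
  using theta_mult_tau by auto

lemma abs_tau: "\<bar>\<tau>\<bar> = inverse \<theta>"
  using gt_1 by (simp add: tau_eq)

text \<open>Source of the constants in the digit estimates: a maximal digit \<open>a\<close> plus a
  remainder \<open>inverse \<theta>\<close> makes exactly \<open>\<theta>\<close>.\<close>

lemma a_eq: "of_int a = \<theta> - inverse \<theta>"
  using tau_eq by (simp add: \<tau>_def)

text \<open>If the top digit is below \<open>a\<close>, the lower digits cannot carry past it. If it
  is \<open>a\<close>, the digit under it is 0, so the rest is controlled two positions down and
  \<open>a * \<theta> ^ k + \<theta> ^ (k - 1) = \<theta> ^ (k + 1)\<close> closes the gap. This is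
  why the induction is a strong one.\<close>

lemma digit_sum_less:
  assumes "greedy_digits a c"
  shows "(\<Sum>j<n. of_int (c j) * \<theta> ^ j) < \<theta> ^ n"
proof (induction n rule: less_induct)
  case (less n)
  show ?case
  proof (cases n)
    case 0
    then show ?thesis by simp
  next
    case n: (Suc k)
    show ?thesis
    proof (cases "c k = a")
      case True
      have "(\<Sum>j<k. of_int (c j) * \<theta> ^ j) < \<theta> ^ k * inverse \<theta>"
      proof (cases k)
        case 0
        then show ?thesis using gt_1 by simp
      next
        case (Suc l)
        then have "c l = 0" using True assms by (auto simp: greedy_digits_def)
        then have "(\<Sum>j<k. of_int (c j) * \<theta> ^ j) < \<theta> ^ l"
          using less.IH[of l] n Suc by simp
        then show ?thesis using Suc gt_1 by (simp add: field_simps)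
      qed
      moreover have "\<theta> ^ n = of_int a * \<theta> ^ k + \<theta> ^ k * inverse \<theta>"
        using n by (simp add: a_eq algebra_simps)
      ultimately show ?thesis using True n by simp
    next
      case False
      moreover have "c k \<le> a" using assms by (auto simp: greedy_digits_def)
      ultimately have "(of_int (c k) + 1 :: real) \<le> of_int a" by linarith
      also have "\<dots> \<le> \<theta>" using gt_1 by (simp add: a_eq)
      finally have "(of_int (c k) + 1) * \<theta> ^ k \<le> \<theta> * \<theta> ^ k"
        using gt_1 by (intro mult_right_mono) auto
      then show ?thesis using less.IH[of k] n by (simp add: algebra_simps)
    qed
  qed
qed

lemma digit_sum_unique:
  assumes "greedy_digits a c" "greedy_digits a d"
    and "(\<Sum>j<n. of_int (c j) * \<theta> ^ j) = (\<Sum>j<n. of_int (d j) * \<theta> ^ j)" "j < n"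
  shows "c j = d j"
  using assms(3,4)
proof (induction n)
  case 0
  then show ?case by simp
next
  case (Suc n)
  \<comment> \<open>A top digit larger by one already outweighs everything below it, by
    \<open>digit_sum_less\<close>. Stated for an arbitrary pair so that it can be applied in both
    directions.\<close>
  have le: "c' n \<le> d' n"
    if cd: "greedy_digits a c'" "greedy_digits a d'"
      "(\<Sum>j<Suc n. of_int (c' j) * \<theta> ^ j) = (\<Sum>j<Suc n. of_int (d' j) * \<theta> ^ j)" for c' d'
  proof (rule ccontr)
    assume "\<not> c' n \<le> d' n"
    then have "(of_int (d' n) + 1 :: real) \<le> of_int (c' n)" by linarith
    then have "(of_int (d' n) + 1) * \<theta> ^ n \<le> of_int (c' n) * \<theta> ^ n"
      using gt_1 by (intro mult_right_mono) auto
    also have "\<dots> \<le> (\<Sum>j<Suc n. of_int (c' j) * \<theta> ^ j)"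
      using cd(1) gt_1 by (auto simp: greedy_digits_def intro!: sum_nonneg)
    finally show False using digit_sum_less[OF cd(2), of n] cd(3) by (simp add: algebra_simps)
  qed
  have "c n = d n"
    using le[OF assms(1,2) Suc.prems(1)] le[OF assms(2,1) Suc.prems(1)[symmetric]] by simp
  then show ?case using Suc by (cases "j = n") auto
qed

text \<open>One induction proves all three, because splitting off the lowest digit turns an upper
  bound for the remaining digits into a lower bound and conversely. The upper bound retains
  \<open>c 0\<close> instead of \<open>a\<close>: the next step has to exploit that the digit above
  a nonzero one is not maximal.\<close>

lemma digit_sum_tau_bounds:
  assumes "greedy_digits a c"
  shows "- 1 \<le> (\<Sum>j<n. of_int (c j) * \<tau> ^ j)"
    and "(\<Sum>j<n. of_int (c j) * \<tau> ^ j) \<le> of_int (c 0) + inverse \<theta>"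
    and "c 0 \<noteq> 0 \<Longrightarrow> n > 0 \<Longrightarrow> inverse \<theta> \<le> (\<Sum>j<n. of_int (c j) * \<tau> ^ j)"
proof -
  have "- 1 \<le> (\<Sum>j<n. of_int (c j) * \<tau> ^ j) \<and>
    (\<Sum>j<n. of_int (c j) * \<tau> ^ j) \<le> of_int (c 0) + inverse \<theta> \<and>
    (c 0 \<noteq> 0 \<longrightarrow> n > 0 \<longrightarrow> inverse \<theta> \<le> (\<Sum>j<n. of_int (c j) * \<tau> ^ j))"
    using assms
  proof (induction n arbitrary: c)
    case 0
    then show ?case using gt_1 by (auto simp: greedy_digits_def)
  next
    case (Suc n)
    \<comment> \<open>Horner step at the lowest digit; multiplication by
      \<open>\<tau> = - inverse \<theta>\<close> produces the change of sign.\<close>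
    define G where "G = (\<Sum>j<n. of_int (c (Suc j)) * \<tau> ^ j)"
    have eq: "(\<Sum>j<Suc n. of_int (c j) * \<tau> ^ j) = of_int (c 0) - G * inverse \<theta>"
      unfolding sum.lessThan_Suc_shift G_def sum_distrib_right sum_negf[symmetric] diff_conv_add_uminus
      by (simp add: tau_eq algebra_simps)
    have c: "0 \<le> c 0" "c 1 \<le> a" "c 1 = a \<longrightarrow> c 0 = 0"
      using Suc.prems by (auto simp: greedy_digits_def)
    have G: "- 1 \<le> G" "G \<le> of_int (c 1) + inverse \<theta>"
      using Suc.IH[OF greedy_digits_shift[OF Suc.prems]] by (auto simp: G_def)
    have inv: "inverse \<theta> > 0" "\<theta> * inverse \<theta> = 1" using gt_1 by auto
    have "G \<le> \<theta>"
      using G(2) c(2) a_eq by (smt (verit) of_int_le_iff)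
    then have 1: "G * inverse \<theta> \<le> 1" using inv by (metis mult_right_mono less_imp_le)
    have 2: "- inverse \<theta> \<le> G * inverse \<theta>" using G(1) inv
      by (metis mult_minus1 mult_right_mono less_imp_le)
    \<comment> \<open>Only here does the greedy condition enter: \<open>c 0 \<noteq> 0\<close>
      forces \<open>c 1 \<le> a - 1\<close>, which lowers the bound for \<open>G\<close> from
      \<open>\<theta>\<close> to \<open>\<theta> - 1\<close>.\<close>
    have 3: "G * inverse \<theta> \<le> 1 - inverse \<theta>" "1 \<le> c 0" if "c 0 \<noteq> 0"
    proof -
      have "of_int (c 1) + 1 \<le> (of_int a :: real)" using c that by linarith
      then have "G \<le> \<theta> - 1" using G(2) a_eq by simp
      then have "G * inverse \<theta> \<le> (\<theta> - 1) * inverse \<theta>" using inv(1) by (intro mult_right_mono) auto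
      then show "G * inverse \<theta> \<le> 1 - inverse \<theta>" using inv(2) by (simp add: algebra_simps)
      show "1 \<le> c 0" using that c(1) by simp
    qed
    have "of_int (c 0) \<ge> (0::real)" using c by simp
    moreover have "of_int (c 0) \<ge> (1::real)" if "c 0 \<noteq> 0" using 3(2)[OF that] by simp
    ultimately show ?case using 1 2 3(1) unfolding eq
      by (smt (verit))
  qed
  then show "- 1 \<le> (\<Sum>j<n. of_int (c j) * \<tau> ^ j)"
    "(\<Sum>j<n. of_int (c j) * \<tau> ^ j) \<le> of_int (c 0) + inverse \<theta>"
    "c 0 \<noteq> 0 \<Longrightarrow> n > 0 \<Longrightarrow> inverse \<theta> \<le> (\<Sum>j<n. of_int (c j) * \<tau> ^ j)" by auto
qed

lemma greedy_sum_pos: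
  assumes "greedy_coeffs a m M b" "b m \<noteq> 0"
  shows "greedy_sum \<theta> m M b > 0"
proof -
  have "m \<le> M" "b m > 0" using assms by (auto simp: greedy_coeffs_def order_less_le)
  have "0 < of_int (b m) * \<theta> powi m" using \<open>b m > 0\<close> gt_1 by simp
  also have "\<dots> \<le> greedy_sum \<theta> m M b"
    unfolding greedy_sum_def using assms \<open>m \<le> M\<close> gt_1
    by (intro member_le_sum) (auto simp: greedy_coeffs_def)
  finally show ?thesis .
qed

text \<open>Dividing the conjugate by \<open>\<tau> powi m\<close>, whose absolute value is
  \<open>\<theta> powi (- m)\<close>, leaves a digit sum with nonzero lowest digit, which lies
  between \<open>inverse \<theta>\<close> and \<open>\<theta>\<close>.\<close>

lemma greedy_sum_tau_bounds:
  assumes "greedy_coeffs a m M b" "b m \<noteq> 0"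
  shows "\<bar>greedy_sum \<tau> m M b\<bar> \<le> \<theta> * \<theta> powi (- m)"
    and "\<theta> powi (- m) \<le> \<theta> * \<bar>greedy_sum \<tau> m M b\<bar>"
proof -
  define c where "c = (\<lambda>j. b (m + int j))"
  define n where "n = nat (M - m + 1)"
  define G where "G = (\<Sum>j<n. of_int (c j) * \<tau> ^ j)"
  have n: "n > 0" "M < m + int n" using assms by (auto simp: greedy_coeffs_def n_def)
  have c: "greedy_digits a c" "c 0 \<noteq> 0"
    using greedy_coeffs_digits[OF assms(1)] assms(2) by (auto simp: c_def)
  have "greedy_sum \<tau> m M b = \<tau> powi m * G"
    using greedy_sum_widen[OF assms(1) _ n(2) tau_nonzero] by (simp add: G_def c_def)
  moreover have "\<bar>\<tau> powi m\<bar> = \<theta> powi (- m)"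
    by (simp add: power_int_abs abs_tau power_int_minus power_int_inverse)
  ultimately have abs: "\<bar>greedy_sum \<tau> m M b\<bar> = \<theta> powi (- m) * \<bar>G\<bar>" by (simp add: abs_mult)
  have le: "inverse \<theta> \<le> G" using digit_sum_tau_bounds(3)[OF c n(1)] by (simp add: G_def)
  have "c 0 \<le> a" using c(1) by (auto simp: greedy_digits_def)
  then have "G \<le> of_int a + inverse \<theta>"
    using digit_sum_tau_bounds(2)[OF c(1), of n] unfolding G_def by (smt (verit) of_int_le_iff)
  then have ge: "G \<le> \<theta>" by (simp add: a_eq)
  have "inverse \<theta> > 0" using gt_1 by simp
  then have G: "\<bar>G\<bar> = G" using le by linarith
  have p: "\<theta> powi (- m) > 0" using gt_1 by simp
  show "\<bar>greedy_sum \<tau> m M b\<bar> \<le> \<theta> * \<theta> powi (- m)"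
    unfolding abs G using ge p by (metis mult.commute mult_right_mono less_imp_le)
  have "1 \<le> \<theta> * G" using le gt_1 by (simp add: field_simps)
  then have "\<theta> powi (- m) * 1 \<le> \<theta> powi (- m) * (\<theta> * G)"
    using p by (intro mult_left_mono) auto
  then show "\<theta> powi (- m) \<le> \<theta> * \<bar>greedy_sum \<tau> m M b\<bar>"
    unfolding abs G by (simp add: mult_ac)
qed

text \<open>Justifies the \<open>THE\<close> in \<open>theta_abs\<close>. Greedy sums are positive,
  so the sign is determined; then both expansions are padded with zeros to a common range, where the
  digits are unique and the lowest nonzero positions must agree.\<close>

lemma greedy_order_unique:
  assumes "greedy_order \<theta> a \<alpha> m" "greedy_order \<theta> a \<alpha> m'"
  shows "m = m'"
proof -
  have le: "k' \<le> k"
    if b: "greedy_coeffs a k M b" "b k \<noteq> 0" and b': "greedy_coeffs a k' M' b'" "b' k' \<noteq> 0"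
      and eq: "greedy_sum \<theta> k M b = greedy_sum \<theta> k' M' b'" for k k' M M' b b'
  proof (rule ccontr)
    assume "\<not> k' \<le> k"
    define n where "n = nat (max M M' - k + 1)"
    have n: "n > 0" "M < k + int n" "M' < k + int n"
      using b(1) by (auto simp: n_def greedy_coeffs_def)
    have "\<theta> \<noteq> 0" "k \<le> k'" using gt_1 \<open>\<not> k' \<le> k\<close> by auto
    then have "\<theta> powi k * (\<Sum>j<n. of_int (b (k + int j)) * \<theta> ^ j) =
        \<theta> powi k * (\<Sum>j<n. of_int (b' (k + int j)) * \<theta> ^ j)"
      using greedy_sum_widen[OF b(1) order_refl n(2)] greedy_sum_widen[OF b'(1) _ n(3)] eq by metis
    then have "(\<Sum>j<n. of_int (b (k + int j)) * \<theta> ^ j) =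
        (\<Sum>j<n. of_int (b' (k + int j)) * \<theta> ^ j)"
      using \<open>\<theta> \<noteq> 0\<close> by simp
    from digit_sum_unique[OF greedy_coeffs_digits[OF b(1)] greedy_coeffs_digits[OF b'(1)] this n(1)]
    have "b k = b' k" by simp
    moreover have "b' k = 0" using b'(1) \<open>\<not> k' \<le> k\<close> by (auto simp: greedy_coeffs_def)
    ultimately show False using b(2) by simp
  qed
  obtain M b where b: "greedy_coeffs a m M b" "b m \<noteq> 0"
      "\<alpha> = greedy_sum \<theta> m M b \<or> \<alpha> = - greedy_sum \<theta> m M b"
    using assms(1) by (auto simp: greedy_order_def)
  obtain M' b' where b': "greedy_coeffs a m' M' b'" "b' m' \<noteq> 0"
      "\<alpha> = greedy_sum \<theta> m' M' b' \<or> \<alpha> = - greedy_sum \<theta> m' M' b'"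
    using assms(2) by (auto simp: greedy_order_def)
  have "greedy_sum \<theta> m M b = greedy_sum \<theta> m' M' b'"
    using b(3) b'(3) greedy_sum_pos[OF b(1,2)] greedy_sum_pos[OF b'(1,2)] by linarith
  then show ?thesis
    using le[OF b(1,2) b'(1,2)] le[OF b'(1,2) b(1,2)] by simp
qed

lemma theta_abs_eq:
  assumes "greedy_order \<theta> a \<alpha> m" "\<alpha> \<noteq> 0"
  shows "theta_abs \<theta> a \<alpha> = \<theta> powi (- m)"
proof -
  have "(THE m. greedy_order \<theta> a \<alpha> m) = m"
    using assms(1) greedy_order_unique by (blast intro: the_equality)
  then show ?thesis using assms(2) by (simp add: theta_abs_def)
qed

end

section \<open>Conjugation\<close>

lemma real_ring_simps [simp]:
  "carrier real_ring = UNIV" "x \<otimes>\<^bsub>real_ring\<^esub> y = x * y" "x \<oplus>\<^bsub>real_ring\<^esub> y = x + y"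
  "\<one>\<^bsub>real_ring\<^esub> = 1" "\<zero>\<^bsub>real_ring\<^esub> = 0"
  by (simp_all add: ring_of_type_algebra_def)

lemma real_ring_minus [simp]: "\<ominus>\<^bsub>real_ring\<^esub> x = - x"
proof -
  interpret field real_ring by (rule field_from_type_algebra)
  show ?thesis by (rule minus_equality) auto
qed

lemma real_ring_inverse [simp]: "x \<noteq> 0 \<Longrightarrow> inv\<^bsub>real_ring\<^esub> x = inverse x"
proof -
  interpret field real_ring by (rule field_from_type_algebra)
  assume "x \<noteq> 0"
  then show ?thesis by (intro comm_inv_char) auto
qed

context quadratic_unit
begin

definition quad_field :: "real set" where
  "quad_field = {x. \<exists>p\<in>\<rat>. \<exists>q\<in>\<rat>. x = p + q * \<theta>}"

definition quad_ints :: "real set" where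
  "quad_ints = {x. \<exists>p q. x = of_int p + of_int q * \<theta>}"

text \<open>Irrationality of \<open>\<theta>\<close> makes the rational coordinates unique, hence
  the value well defined on \<open>quad_field\<close>; outside it the value is unspecified.\<close>

definition galois :: "real \<Rightarrow> real" where
  "galois x = (THE y. \<exists>p\<in>\<rat>. \<exists>q\<in>\<rat>. x = p + q * \<theta> \<and> y = p + q * \<tau>)"

lemma rat_lincomb_zero:
  assumes "p \<in> \<rat>" "q \<in> \<rat>" "\<eta> \<notin> \<rat>" "p + q * \<eta> = (0::real)"
  shows "p = 0 \<and> q = 0"
proof -
  have "q = 0"
  proof (rule ccontr)
    assume "q \<noteq> 0"
    then have "\<eta> = - p / q" using assms(4) by (simp add: field_simps)
    then show False using assms(1-3) by auto
  qed
  then show ?thesis using assms(4) by simp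
qed

lemma galois_lincomb:
  assumes "p \<in> \<rat>" "q \<in> \<rat>"
  shows "galois (p + q * \<theta>) = p + q * \<tau>"
  unfolding galois_def
proof (rule the_equality)
  fix y assume "\<exists>p'\<in>\<rat>. \<exists>q'\<in>\<rat>. p + q * \<theta> = p' + q' * \<theta> \<and> y = p' + q' * \<tau>"
  then obtain p' q' where *: "p' \<in> \<rat>" "q' \<in> \<rat>" "p + q * \<theta> = p' + q' * \<theta>" "y = p' + q' * \<tau>"
    by blast
  then have "(p - p') + (q - q') * \<theta> = 0" by (simp add: algebra_simps)
  then have "p - p' = 0 \<and> q - q' = 0"
    using assms * irrational by (intro rat_lincomb_zero) auto
  then show "y = p + q * \<tau>" using * by simp
qed (use assms in auto)

lemma quad_fieldE:
  assumes "x \<in> quad_field"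
  obtains p q where "p \<in> \<rat>" "q \<in> \<rat>" "x = p + q * \<theta>" "galois x = p + q * \<tau>"
  using assms galois_lincomb unfolding quad_field_def by blast

lemma quad_intsE:
  assumes "x \<in> quad_ints"
  obtains p q where "x = of_int p + of_int q * \<theta>" "galois x = of_int p + of_int q * \<tau>"
  using assms galois_lincomb[OF Rats_of_int Rats_of_int] unfolding quad_ints_def by blast

lemma quad_intsI: "x = of_int p + of_int q * \<theta> \<Longrightarrow> x \<in> quad_ints"
  unfolding quad_ints_def by blast

lemma quad_ints_subset: "quad_ints \<subseteq> quad_field"
  unfolding quad_ints_def quad_field_def by (auto intro: Rats_of_int)

text \<open>Both roots satisfy the same quadratic equation, so products have the same coordinates
  with respect to either root. This is the multiplicativity of conjugation.\<close>

lemma lincomb_mult: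
  "(p + q * \<theta>) * (p' + q' * \<theta>) = (p * p' + q * q') + (p * q' + q * p' + q * q' * of_int a) * \<theta>"
  "(p + q * \<tau>) * (p' + q' * \<tau>) = (p * p' + q * q') + (p * q' + q * p' + q * q' * of_int a) * \<tau>"
proof -
  have "(p + q * x) * (p' + q' * x) = (p * p' + q * q') + (p * q' + q * p' + q * q' * of_int a) * x"
    if "x * x = of_int a * x + 1" for x
  proof -
    have "(p + q * x) * (p' + q' * x) = p * p' + (p * q' + q * p') * x + q * q' * (x * x)"
      by (simp add: algebra_simps)
    then show ?thesis unfolding that by (simp add: algebra_simps)
  qed
  then show "(p + q * \<theta>) * (p' + q' * \<theta>) = (p * p' + q * q') + (p * q' + q * p' + q * q' * of_int a) * \<theta>"
    "(p + q * \<tau>) * (p' + q' * \<tau>) = (p * p' + q * q') + (p * q' + q * p' + q * q' * of_int a) * \<tau>"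
    using square tau_square by (auto simp: power2_eq_square)
qed

section \<open>Conjugation as an injective homomorphism\<close>

lemma galois_add:
  assumes "x \<in> quad_field" "y \<in> quad_field"
  shows "x + y \<in> quad_field" "galois (x + y) = galois x + galois y"
proof -
  obtain p q where x: "p \<in> \<rat>" "q \<in> \<rat>" "x = p + q * \<theta>" "galois x = p + q * \<tau>"
    using quad_fieldE[OF assms(1)] .
  obtain p' q' where y: "p' \<in> \<rat>" "q' \<in> \<rat>" "y = p' + q' * \<theta>" "galois y = p' + q' * \<tau>"
    using quad_fieldE[OF assms(2)] .
  have eq: "x + y = (p + p') + (q + q') * \<theta>" using x y by (simp add: algebra_simps)
  show "x + y \<in> quad_field"
    unfolding eq quad_field_def using x y Rats_add by blast
  show "galois (x + y) = galois x + galois y"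
    unfolding eq using x y by (subst galois_lincomb) (auto simp: algebra_simps)
qed

lemma galois_mult:
  assumes "x \<in> quad_field" "y \<in> quad_field"
  shows "x * y \<in> quad_field" "galois (x * y) = galois x * galois y"
proof -
  obtain p q where x: "p \<in> \<rat>" "q \<in> \<rat>" "x = p + q * \<theta>" "galois x = p + q * \<tau>"
    using quad_fieldE[OF assms(1)] .
  obtain p' q' where y: "p' \<in> \<rat>" "q' \<in> \<rat>" "y = p' + q' * \<theta>" "galois y = p' + q' * \<tau>"
    using quad_fieldE[OF assms(2)] .
  have rats: "p * p' + q * q' \<in> \<rat>" "p * q' + q * p' + q * q' * of_int a \<in> \<rat>"
    using x y by (auto intro!: Rats_add Rats_mult)
  show "x * y \<in> quad_field"
    unfolding x(3) y(3) lincomb_mult quad_field_def using rats by blast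
  show "galois (x * y) = galois x * galois y"
    unfolding x(4) y(4) lincomb_mult unfolding x(3) y(3) lincomb_mult
    by (rule galois_lincomb[OF rats])
qed

lemma rat_in_quad_field: "p \<in> \<rat> \<Longrightarrow> p \<in> quad_field"
  and galois_rat: "p \<in> \<rat> \<Longrightarrow> galois p = p"
proof -
  assume "p \<in> \<rat>"
  then show "p \<in> quad_field"
    unfolding quad_field_def using add_0_right[of p] mult_zero_left[of \<theta>] Rats_0
    by (intro CollectI bexI[of _ p] bexI[of _ 0]) auto
next
  assume "p \<in> \<rat>"
  then show "galois p = p" using galois_lincomb[of p 0] by simp
qed

lemma galois_of_int [simp]: "galois (of_int n) = of_int n"
  and galois_0 [simp]: "galois 0 = 0" and galois_1 [simp]: "galois 1 = 1"
  by (auto intro: galois_rat)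

lemma theta_in_quad_ints: "\<theta> \<in> quad_ints" and galois_theta: "galois \<theta> = \<tau>"
  using galois_lincomb[of 0 1] by (auto intro: quad_intsI[of _ 0 1])

lemma galois_uminus:
  assumes "x \<in> quad_field"
  shows "- x \<in> quad_field" "galois (- x) = - galois x"
  using galois_mult[of "-1" x] rat_in_quad_field[of "-1"] galois_rat[of "-1"] assms by auto

lemma galois_diff:
  assumes "x \<in> quad_field" "y \<in> quad_field"
  shows "x - y \<in> quad_field" "galois (x - y) = galois x - galois y"
  using galois_add[of x "- y"] galois_uminus assms by auto

lemma galois_eq_0_iff:
  assumes "x \<in> quad_field"
  shows "galois x = 0 \<longleftrightarrow> x = 0"
proof -
  obtain p q where x: "p \<in> \<rat>" "q \<in> \<rat>" "x = p + q * \<theta>" "galois x = p + q * \<tau>"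
    using quad_fieldE[OF assms] .
  show ?thesis
    using rat_lincomb_zero[OF x(1,2) tau_irrational] x by auto
qed

lemma inj_on_galois: "inj_on galois quad_field"
  by (rule inj_onI) (metis galois_diff galois_eq_0_iff right_minus_eq)

text \<open>The inverse is the conjugate divided by the norm, and the norm is rational.\<close>

lemma quad_field_inverse:
  assumes "x \<in> quad_field"
  shows "inverse x \<in> quad_field"
proof (cases "x = 0")
  case False
  obtain p q where x: "p \<in> \<rat>" "q \<in> \<rat>" "x = p + q * \<theta>" "galois x = p + q * \<tau>"
    using quad_fieldE[OF assms] .
  \<comment> \<open>Back in the basis of 1 and \<open>\<theta>\<close>, so that
    \<open>lincomb_mult\<close> can compute the norm and the conjugate is seen to lie in the
    field.\<close>
  have conj: "galois x = (p + q * of_int a) + (- q) * \<theta>"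
    by (simp add: x(4) \<tau>_def algebra_simps)
  define N where "N = x * galois x"
  have "N = p * p + p * q * of_int a - q * q"
    unfolding N_def conj unfolding x(3) lincomb_mult by (simp add: algebra_simps)
  then have "inverse N \<in> quad_field" using x by (auto intro!: rat_in_quad_field)
  moreover have "galois x \<in> quad_field"
    unfolding conj quad_field_def using x
    by (intro CollectI bexI[of _ "p + q * of_int a"] bexI[of _ "-q"]) auto
  moreover have "inverse x = galois x * inverse N"
    using False galois_eq_0_iff[OF assms] by (simp add: N_def)
  ultimately show ?thesis using galois_mult(1) by simp
qed (simp add: rat_in_quad_field)

section \<open>The ring generated by the unit, and conjugates of greedy sums\<close>

lemma quad_ints_add: "x \<in> quad_ints \<Longrightarrow> y \<in> quad_ints \<Longrightarrow> x + y \<in> quad_ints"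
proof (elim quad_intsE)
  fix p q p' q' assume "x = of_int p + of_int q * \<theta>" "y = of_int p' + of_int q' * \<theta>"
  then show ?thesis by (intro quad_intsI[of _ "p + p'" "q + q'"]) (simp add: algebra_simps)
qed

lemma quad_ints_mult: "x \<in> quad_ints \<Longrightarrow> y \<in> quad_ints \<Longrightarrow> x * y \<in> quad_ints"
proof (elim quad_intsE)
  fix p q p' q' assume "x = of_int p + of_int q * \<theta>" "y = of_int p' + of_int q' * \<theta>"
  then show ?thesis
    by (intro quad_intsI[of _ "p * p' + q * q'" "p * q' + q * p' + q * q' * a"]) (simp add: lincomb_mult)
qed

lemma quad_ints_of_int: "of_int n \<in> quad_ints"
  by (rule quad_intsI[of _ n 0]) simp

lemma quad_ints_uminus: "x \<in> quad_ints \<Longrightarrow> - x \<in> quad_ints"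
  using quad_ints_mult[OF quad_ints_of_int[of "-1"]] by simp

lemma quad_ints_diff: "x \<in> quad_ints \<Longrightarrow> y \<in> quad_ints \<Longrightarrow> x - y \<in> quad_ints"
  using quad_ints_add[OF _ quad_ints_uminus] by fastforce

lemma quad_ints_sum: "(\<And>i. i \<in> I \<Longrightarrow> f i \<in> quad_ints) \<Longrightarrow> sum f I \<in> quad_ints"
  using quad_ints_of_int[of 0] by (induction I rule: infinite_finite_induct) (auto intro: quad_ints_add)

lemma galois_sum:
  "(\<And>i. i \<in> I \<Longrightarrow> f i \<in> quad_ints) \<Longrightarrow> galois (sum f I) = (\<Sum>i\<in>I. galois (f i))"
proof (induction I rule: infinite_finite_induct)
  case (insert i I)
  then show ?case
    using galois_add(2)[of "f i" "sum f I"] quad_ints_subset quad_ints_sum[of I f] by auto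
qed auto

lemma galois_power:
  assumes "x \<in> quad_ints"
  shows "x ^ n \<in> quad_ints" "galois (x ^ n) = galois x ^ n"
proof -
  have "x ^ n \<in> quad_ints \<and> galois (x ^ n) = galois x ^ n"
  proof (induction n)
    case 0
    then show ?case using quad_ints_of_int[of 1] by simp
  next
    case (Suc n)
    then show ?case
      using assms quad_ints_mult galois_mult(2)[of x "x ^ n"] quad_ints_subset by auto
  qed
  then show "x ^ n \<in> quad_ints" "galois (x ^ n) = galois x ^ n" by auto
qed

lemma galois_theta_powi: "\<theta> powi i \<in> quad_ints" "galois (\<theta> powi i) = \<tau> powi i"
proof -
  \<comment> \<open>Since \<open>\<theta>\<close> is a unit with inverse
    \<open>\<theta> - a\<close>, negative powers stay in \<open>quad_ints\<close> as well.\<close>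
  have inv: "inverse \<theta> = of_int (- a) + of_int 1 * \<theta>" "inverse \<tau> = - \<theta>"
    using tau_eq by (auto simp: \<tau>_def)
  have "galois (inverse \<theta>) = of_int (- a) + of_int 1 * \<tau>"
    unfolding inv(1) by (rule galois_lincomb) auto
  then have gal: "galois (inverse \<theta>) = inverse \<tau>" unfolding inv(2) by (simp add: \<tau>_def)
  have "inverse \<theta> \<in> quad_ints" using inv(1) by (rule quad_intsI)
  from galois_power[OF this] galois_power[OF theta_in_quad_ints]
  show "\<theta> powi i \<in> quad_ints" "galois (\<theta> powi i) = \<tau> powi i"
    unfolding power_int_def gal galois_theta by auto
qed

lemma galois_greedy_sum:
  "greedy_sum \<theta> m M b \<in> quad_ints" "galois (greedy_sum \<theta> m M b) = greedy_sum \<tau> m M b"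
proof -
  have ints: "of_int (b i) * \<theta> powi i \<in> quad_ints" for i
    by (intro quad_ints_mult quad_ints_of_int galois_theta_powi)
  show "greedy_sum \<theta> m M b \<in> quad_ints"
    unfolding greedy_sum_def by (intro quad_ints_sum ints)
  have "of_int (b i) \<in> quad_field" "\<theta> powi i \<in> quad_field" for i
    using quad_ints_subset quad_ints_of_int galois_theta_powi(1) by auto
  then show "galois (greedy_sum \<theta> m M b) = greedy_sum \<tau> m M b"
    unfolding greedy_sum_def galois_sum[OF ints]
    by (simp add: galois_mult galois_theta_powi)
qed

section \<open>Identification of the number field and integrality\<close>

lemma number_field_eq: "number_field \<theta> = quad_field"
proof
  show "number_field \<theta> \<subseteq> quad_field"
  proof
    fix x assume "x \<in> number_field \<theta>"
    then show "x \<in> quad_field"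
      unfolding number_field_def
    proof induction
      case (m_inv h)
      then show ?case using quad_field_inverse by simp
    qed (use theta_in_quad_ints quad_ints_subset in
        \<open>auto intro: galois_add(1) galois_mult(1) galois_uminus(1) rat_in_quad_field\<close>)
  qed
  have add: "x + y \<in> number_field \<theta>" and mult: "x * y \<in> number_field \<theta>"
    if "x \<in> number_field \<theta>" "y \<in> number_field \<theta>" for x y
    using that generate_field.eng_add[of _ real_ring] generate_field.eng_mult[of _ real_ring]
    by (auto simp: number_field_def)
  have one: "1 \<in> number_field \<theta>" and gen: "\<theta> \<in> number_field \<theta>"
    using generate_field.one[of real_ring] by (auto simp: number_field_def intro: generate_field.incl)
  have uminus: "- x \<in> number_field \<theta>" if "x \<in> number_field \<theta>" for x
    using that generate_field.a_inv[of _ real_ring] by (auto simp: number_field_def)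
  have zero: "0 \<in> number_field \<theta>" using add[OF one uminus[OF one]] by simp
  have inverse: "inverse x \<in> number_field \<theta>" if "x \<in> number_field \<theta>" for x
    using that zero generate_field.m_inv[of x real_ring]
    by (cases "x = 0") (auto simp: number_field_def)
  have nat: "of_nat n \<in> number_field \<theta>" for n
    by (induction n) (auto intro: zero one add)
  have int: "of_int n \<in> number_field \<theta>" for n
    by (cases n rule: int_cases2) (auto intro: nat uminus)
  have rat: "p \<in> number_field \<theta>" if "p \<in> \<rat>" for p
    using that by (cases rule: Rats_cases') (auto simp: divide_inverse intro: mult int inverse)
  show "quad_field \<subseteq> number_field \<theta>"
    unfolding quad_field_def using rat add mult gen by auto
qed

lemma quad_ints_algebraic_int: "x \<in> quad_ints \<Longrightarrow> algebraic_int x"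
proof (elim quad_intsE)
  fix p q assume x: "x = of_int p + of_int q * \<theta>"
  \<comment> \<open>The characteristic polynomial of \<open>x\<close>: constant term the norm,
    linear coefficient minus the trace.\<close>
  let ?f = "[: p * p + p * q * a - q * q, - (2 * p + q * a), 1 :]"
  have "poly (map_poly of_int ?f) x =
      of_int (p * p + p * q * a - q * q) - of_int (2 * p + q * a) * x + x * x"
    by (simp add: map_poly_pCons algebra_simps)
  also have "\<dots> = 0"
    unfolding x lincomb_mult by (simp add: algebra_simps)
  finally show ?thesis
    unfolding algebraic_int_altdef_ipoly by (intro exI[of _ ?f]) simp
qed

end

section \<open>Comparison of the two absolute values\<close>

locale greedy_quadratic_unit = quadratic_unit +
  assumes greedy: "\<forall>\<alpha>\<in>integer_ring \<theta>. \<alpha> \<noteq> 0 \<longrightarrow> (\<exists>m. greedy_order \<theta> a \<alpha> m)"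
begin

text \<open>A greedy expansion writes an integer as an integral combination of powers of
  \<open>\<theta>\<close>, so existence of expansions rules out integers outside
  \<open>quad_ints\<close>.\<close>

lemma integer_ring_eq: "integer_ring \<theta> = quad_ints"
proof
  show "integer_ring \<theta> \<subseteq> quad_ints"
  proof
    fix x assume x: "x \<in> integer_ring \<theta>"
    show "x \<in> quad_ints"
    proof (cases "x = 0")
      case True
      then show ?thesis using quad_ints_of_int[of 0] by simp
    next
      case False
      then obtain m M b where "x = greedy_sum \<theta> m M b \<or> x = - greedy_sum \<theta> m M b"
        using greedy x unfolding greedy_order_def by blast
      then show ?thesis using galois_greedy_sum(1) quad_ints_uminus by blast
    qed
  qed
  show "quad_ints \<subseteq> integer_ring \<theta>"
    using quad_ints_subset quad_ints_algebraic_int by (auto simp: integer_ring_def number_field_eq)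
qed

text \<open>Besides the two estimates this records that the value is a power of
  \<open>\<theta>\<close>; that discreteness is what \<open>finite_limsups\<close> later depends
  on.\<close>

lemma theta_abs_cases:
  assumes "x \<in> quad_ints" "x \<noteq> 0"
  obtains k where "theta_abs \<theta> a x = \<theta> powi k"
    "\<bar>galois x\<bar> \<le> \<theta> * \<theta> powi k" "\<theta> powi k \<le> \<theta> * \<bar>galois x\<bar>"
proof -
  obtain m where m: "greedy_order \<theta> a x m"
    using greedy assms by (auto simp: integer_ring_eq)
  then obtain M b where b: "greedy_coeffs a m M b" "b m \<noteq> 0"
      "x = greedy_sum \<theta> m M b \<or> x = - greedy_sum \<theta> m M b"
    by (auto simp: greedy_order_def)
  have "\<bar>galois x\<bar> = \<bar>greedy_sum \<tau> m M b\<bar>"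
    using b(3) galois_greedy_sum[of m M b] galois_uminus(2) quad_ints_subset by auto
  then show ?thesis
    using that[OF theta_abs_eq[OF m assms(2)]] greedy_sum_tau_bounds[OF b(1,2)] by simp
qed

lemma theta_abs_bounds:
  assumes "x \<in> quad_ints"
  shows "theta_abs \<theta> a x \<ge> 0" "\<bar>galois x\<bar> \<le> \<theta> * theta_abs \<theta> a x"
    "theta_abs \<theta> a x \<le> \<theta> * \<bar>galois x\<bar>"
proof -
  have "theta_abs \<theta> a x \<ge> 0 \<and> \<bar>galois x\<bar> \<le> \<theta> * theta_abs \<theta> a x \<and>
    theta_abs \<theta> a x \<le> \<theta> * \<bar>galois x\<bar>"
  proof (cases "x = 0")
    case True
    then show ?thesis by (simp add: theta_abs_def)
  next
    case False
    show ?thesis by (rule theta_abs_cases[OF assms False]) (use gt_1 in auto)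
  qed
  then show "theta_abs \<theta> a x \<ge> 0" "\<bar>galois x\<bar> \<le> \<theta> * theta_abs \<theta> a x"
    "theta_abs \<theta> a x \<le> \<theta> * \<bar>galois x\<bar>" by auto
qed

lemma theta_cauchy_iff:
  assumes "\<And>n. f n \<in> quad_ints"
  shows "theta_cauchy \<theta> a f \<longleftrightarrow> convergent (\<lambda>n. galois (f n))"
proof -
  have diff: "f i - f j \<in> quad_ints" "galois (f i - f j) = galois (f i) - galois (f j)" for i j
    using quad_ints_diff[OF assms assms] galois_diff(2)[OF subsetD subsetD] assms quad_ints_subset
    by blast+
  have "theta_cauchy \<theta> a f" if C: "Cauchy (\<lambda>n. galois (f n))"
    unfolding theta_cauchy_def
  proof (intro allI impI)
    fix \<epsilon> :: real assume "\<epsilon> > 0"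
    then have "\<epsilon> / \<theta> > 0" using gt_1 by simp
    then obtain N where N: "\<And>i j. i \<ge> N \<Longrightarrow> j \<ge> N \<Longrightarrow> \<bar>galois (f i) - galois (f j)\<bar> < \<epsilon> / \<theta>"
      using C unfolding Cauchy_def dist_real_def by blast
    have "theta_abs \<theta> a (f i - f j) < \<epsilon>" if "i \<ge> N" "j \<ge> N" for i j
    proof -
      have "theta_abs \<theta> a (f i - f j) \<le> \<theta> * \<bar>galois (f i) - galois (f j)\<bar>"
        using theta_abs_bounds(3)[OF diff(1)] by (simp add: diff(2))
      also have "\<dots> < \<epsilon>" using N[OF that] gt_1 by (simp add: field_simps)
      finally show ?thesis .
    qed
    then show "\<exists>N. \<forall>i\<ge>N. \<forall>j\<ge>N. theta_abs \<theta> a (f i - f j) < \<epsilon>" by blast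
  qed
  moreover have "Cauchy (\<lambda>n. galois (f n))" if C: "theta_cauchy \<theta> a f"
    unfolding Cauchy_def dist_real_def
  proof (intro allI impI)
    fix \<epsilon> :: real assume "\<epsilon> > 0"
    then have "\<epsilon> / \<theta> > 0" using gt_1 by simp
    then obtain N where N: "\<And>i j. i \<ge> N \<Longrightarrow> j \<ge> N \<Longrightarrow> theta_abs \<theta> a (f i - f j) < \<epsilon> / \<theta>"
      using C unfolding theta_cauchy_def by blast
    have "\<bar>galois (f i) - galois (f j)\<bar> < \<epsilon>" if "i \<ge> N" "j \<ge> N" for i j
    proof -
      have "\<bar>galois (f i) - galois (f j)\<bar> \<le> \<theta> * theta_abs \<theta> a (f i - f j)"
        using theta_abs_bounds(2)[OF diff(1)] by (simp add: diff(2))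
      also have "\<dots> < \<epsilon>" using N[OF that] gt_1 by (simp add: field_simps)
      finally show ?thesis .
    qed
    then show "\<exists>N. \<forall>i\<ge>N. \<forall>j\<ge>N. \<bar>galois (f i) - galois (f j)\<bar> < \<epsilon>" by blast
  qed
  ultimately show ?thesis unfolding Cauchy_convergent_iff[symmetric] by blast
qed

lemma theta_abs_tendsto_0_iff:
  assumes "\<And>n. f n \<in> quad_ints"
  shows "(\<lambda>n. theta_abs \<theta> a (f n)) \<longlonglongrightarrow> 0 \<longleftrightarrow> (\<lambda>n. galois (f n)) \<longlonglongrightarrow> 0"
proof
  assume "(\<lambda>n. theta_abs \<theta> a (f n)) \<longlonglongrightarrow> 0"
  then have "(\<lambda>n. \<theta> * theta_abs \<theta> a (f n)) \<longlonglongrightarrow> 0"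
    by (rule tendsto_mult_right_zero)
  then show "(\<lambda>n. galois (f n)) \<longlonglongrightarrow> 0"
    by (rule Lim_null_comparison[rotated]) (simp add: theta_abs_bounds assms)
next
  assume "(\<lambda>n. galois (f n)) \<longlonglongrightarrow> 0"
  then have "(\<lambda>n. \<theta> * \<bar>galois (f n)\<bar>) \<longlonglongrightarrow> 0"
    by (intro tendsto_mult_right_zero tendsto_rabs_zero)
  then show "(\<lambda>n. theta_abs \<theta> a (f n)) \<longlonglongrightarrow> 0"
    by (rule Lim_null_comparison[rotated]) (simp add: theta_abs_bounds assms)
qed

end

section \<open>The completion is the field of real numbers\<close>

context greedy_quadratic_unit
begin

abbreviation R where "R \<equiv> cauchy_ring \<theta> a"
abbreviation C where "C \<equiv> theta_completion \<theta> a"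

definition seq_value :: "(nat \<Rightarrow> real) \<Rightarrow> real" where
  "seq_value f = lim (\<lambda>n. galois (f n))"

text \<open>\<open>seq_value\<close> is constant on each coset; the form is that of the map in the
  first isomorphism theorem \<open>FactRing_iso_set\<close>.\<close>

definition value_of :: "(nat \<Rightarrow> real) set \<Rightarrow> real" where
  "value_of F = the_elem (seq_value ` F)"

lemma carrier_R: "f \<in> carrier R \<longleftrightarrow> (\<forall>n. f n \<in> quad_ints) \<and> convergent (\<lambda>n. galois (f n))"
  using theta_cauchy_iff by (auto simp: cauchy_ring_def integer_ring_eq)

lemma R_simps [simp]:
  "f \<otimes>\<^bsub>R\<^esub> g = (\<lambda>n. f n * g n)" "f \<oplus>\<^bsub>R\<^esub> g = (\<lambda>n. f n + g n)"
  "\<one>\<^bsub>R\<^esub> = (\<lambda>_. 1)" "\<zero>\<^bsub>R\<^esub> = (\<lambda>_. 0)"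
  by (simp_all add: cauchy_ring_def)

lemma carrier_RI:
  assumes "\<And>n. f n \<in> quad_ints" "(\<lambda>n. galois (f n)) \<longlonglongrightarrow> x"
  shows "f \<in> carrier R" "seq_value f = x"
  using assms limI[OF assms(2)] by (auto simp: carrier_R convergent_def seq_value_def)

lemma carrier_RD:
  assumes "f \<in> carrier R"
  shows "f n \<in> quad_ints" "f n \<in> quad_field" "(\<lambda>n. galois (f n)) \<longlonglongrightarrow> seq_value f"
  using assms quad_ints_subset by (auto simp: carrier_R seq_value_def convergent_LIMSEQ_iff)

lemma R_closed:
  assumes "f \<in> carrier R" "g \<in> carrier R"
  shows "(\<lambda>n. f n + g n) \<in> carrier R" "seq_value (\<lambda>n. f n + g n) = seq_value f + seq_value g"
    "(\<lambda>n. f n * g n) \<in> carrier R" "seq_value (\<lambda>n. f n * g n) = seq_value f * seq_value g"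
proof -
  have "(\<lambda>n. galois (f n + g n)) \<longlonglongrightarrow> seq_value f + seq_value g"
    using tendsto_add[OF carrier_RD(3)[OF assms(1)] carrier_RD(3)[OF assms(2)]]
    by (simp add: galois_add(2) carrier_RD(2) assms)
  from carrier_RI[OF quad_ints_add[OF carrier_RD(1)[OF assms(1)] carrier_RD(1)[OF assms(2)]] this]
  show "(\<lambda>n. f n + g n) \<in> carrier R" "seq_value (\<lambda>n. f n + g n) = seq_value f + seq_value g" .
  have "(\<lambda>n. galois (f n * g n)) \<longlonglongrightarrow> seq_value f * seq_value g"
    using tendsto_mult[OF carrier_RD(3)[OF assms(1)] carrier_RD(3)[OF assms(2)]]
    by (simp add: galois_mult(2) carrier_RD(2) assms)
  from carrier_RI[OF quad_ints_mult[OF carrier_RD(1)[OF assms(1)] carrier_RD(1)[OF assms(2)]] this]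
  show "(\<lambda>n. f n * g n) \<in> carrier R" "seq_value (\<lambda>n. f n * g n) = seq_value f * seq_value g" .
qed

lemma R_const:
  assumes "x \<in> quad_ints"
  shows "(\<lambda>_. x) \<in> carrier R" "seq_value (\<lambda>_. x) = galois x"
  by (rule carrier_RI[OF assms tendsto_const])+

lemma R_consts: "(\<lambda>_. 0) \<in> carrier R" "(\<lambda>_. 1) \<in> carrier R" "(\<lambda>_. - 1) \<in> carrier R"
  using R_const(1)[OF quad_ints_of_int[of 0]] R_const(1)[OF quad_ints_of_int[of 1]]
    R_const(1)[OF quad_ints_of_int[of "-1"]] by auto

lemma cring_R: "cring R"
proof (rule cringI)
  show "abelian_group R"
  proof (rule abelian_groupI)
    fix f assume f: "f \<in> carrier R"
    show "\<exists>g\<in>carrier R. g \<oplus>\<^bsub>R\<^esub> f = \<zero>\<^bsub>R\<^esub>"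
      using R_closed(3)[OF R_consts(3) f] by (intro bexI[of _ "\<lambda>n. - 1 * f n"]) auto
  qed (auto simp: R_closed R_consts algebra_simps)
  show "Group.comm_monoid R"
    by (rule comm_monoidI) (auto simp: R_closed R_consts algebra_simps)
qed (auto simp: algebra_simps)

lemma seq_value_hom: "ring_hom_ring R real_ring seq_value"
  using cring.axioms(1)[OF cring_R] ring_from_type_algebra R_const[OF quad_ints_of_int[of 1]]
  by (intro ring_hom_ringI) (auto simp: R_closed)

text \<open>As a kernel, \<open>null_ideal\<close> is an ideal with no further work, and the
  completion becomes a quotient to which the isomorphism theorem applies.\<close>

lemma null_ideal_eq: "null_ideal \<theta> a = a_kernel R real_ring seq_value"
proof -
  have "(\<lambda>n. theta_abs \<theta> a (f n)) \<longlonglongrightarrow> 0 \<longleftrightarrow> seq_value f = 0" if f: "f \<in> carrier R" for f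
  proof -
    have "(\<lambda>n. galois (f n)) \<longlonglongrightarrow> 0 \<longleftrightarrow> seq_value f = 0"
      using LIMSEQ_unique[OF carrier_RD(3)[OF f], of 0] carrier_RD(3)[OF f] by auto
    then show ?thesis using theta_abs_tendsto_0_iff[OF carrier_RD(1)[OF f]] by simp
  qed
  then show ?thesis unfolding null_ideal_def a_kernel_def' real_ring_simps by blast
qed

text \<open>Since \<open>\<bar>\<tau>\<bar> < 1\<close>, the integers \<open>\<lfloor>x / \<tau> ^ n\<rfloor> * \<theta> ^ n\<close> have conjugates tending to \<open>x\<close>.\<close>

lemma seq_value_surj: "seq_value ` carrier R = UNIV"
proof -
  have "x \<in> seq_value ` carrier R" for x
  proof -
    define f where "f n = of_int \<lfloor>x / \<tau> ^ n\<rfloor> * \<theta> ^ n" for n :: nat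
    note pow = galois_power[OF theta_in_quad_ints]
    have ints: "f n \<in> quad_ints" for n
      unfolding f_def by (intro quad_ints_mult quad_ints_of_int pow)
    have gal: "galois (f n) = of_int \<lfloor>x / \<tau> ^ n\<rfloor> * \<tau> ^ n" for n
      using galois_mult(2)[of "of_int \<lfloor>x / \<tau> ^ n\<rfloor>" "\<theta> ^ n"] pow quad_ints_of_int quad_ints_subset
      by (auto simp: f_def galois_theta)
    have le: "norm (galois (f n) - x) \<le> inverse \<theta> ^ n" for n
    proof -
      have "galois (f n) - x = (of_int \<lfloor>x / \<tau> ^ n\<rfloor> - x / \<tau> ^ n) * \<tau> ^ n"
        using tau_nonzero by (simp add: gal left_diff_distrib)
      moreover have "\<bar>of_int \<lfloor>x / \<tau> ^ n\<rfloor> - x / \<tau> ^ n\<bar> \<le> 1" by linarith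
      ultimately show ?thesis
        using gt_1 by (simp add: abs_mult power_abs abs_tau mult_left_le_one_le)
    qed
    have lim: "(\<lambda>n. inverse \<theta> ^ n) \<longlonglongrightarrow> 0"
      using gt_1 by (intro LIMSEQ_power_zero) (auto simp: inverse_less_1_iff)
    have "(\<lambda>n. galois (f n) - x) \<longlonglongrightarrow> 0"
      by (rule Lim_null_comparison[OF eventuallyI lim]) (rule le)
    then have "(\<lambda>n. galois (f n)) \<longlonglongrightarrow> x" by (rule LIM_zero_cancel)
    from carrier_RI[OF ints this] show ?thesis by blast
  qed
  then show ?thesis by auto
qed

lemma value_of_iso: "value_of \<in> ring_iso C real_ring"
  using ring_hom_ring.FactRing_iso_set[OF seq_value_hom] seq_value_surj
  by (simp add: theta_completion_def null_ideal_eq value_of_def[abs_def])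

lemma ring_C: "ring C"
  using ideal.quotient_is_ring[OF ring_hom_ring.kernel_is_ideal[OF seq_value_hom]]
  by (simp add: theta_completion_def null_ideal_eq)

text \<open>Inverses are never built from sequences; the field structure is carried over from the
  reals along the inverse of \<open>value_of\<close>.\<close>

lemma field_C: "field C"
proof -
  have real: "field real_ring" by (rule field_from_type_algebra)
  define h where "h = inv_into (carrier C) value_of"
  have h: "h \<in> ring_iso real_ring C"
    unfolding h_def by (rule ring_iso_set_sym[OF ring_C value_of_iso])
  have "h \<in> ring_hom real_ring C" using h by (simp add: ring_iso_def)
  then have "h \<zero>\<^bsub>real_ring\<^esub> = \<zero>\<^bsub>C\<^esub>"
    using ring_hom_zero ring_from_type_algebra ring_C by blast
  \<comment> \<open>The transport theorem speaks of \<open>C\<close> with its zero replaced by the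
    image of 0, which is the zero it already has.\<close>
  then have "C\<lparr>zero := h \<zero>\<^bsub>real_ring\<^esub>\<rparr> = C" by (intro ring.equality) auto
  then show ?thesis using field.ring_iso_imp_img_field[OF real h] by metis
qed

section \<open>Arithmetic of the completion in terms of real values\<close>

lemma value_of_simps:
  assumes "F \<in> carrier C" "G \<in> carrier C"
  shows "value_of (F \<oplus>\<^bsub>C\<^esub> G) = value_of F + value_of G"
    "value_of (F \<otimes>\<^bsub>C\<^esub> G) = value_of F * value_of G"
  using ring_iso_memE(2,3)[OF value_of_iso assms] by auto

lemma bij_value_of: "bij_betw value_of (carrier C) UNIV"
  using ring_iso_memE(5)[OF value_of_iso] by simp

lemma value_of_eq_iff:
  "F \<in> carrier C \<Longrightarrow> G \<in> carrier C \<Longrightarrow> value_of F = value_of G \<longleftrightarrow> F = G"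
  using inj_on_eq_iff[OF bij_betw_imp_inj_on[OF bij_value_of]] by blast

lemma value_of_zero: "value_of \<zero>\<^bsub>C\<^esub> = 0"
proof -
  interpret C: field C by (rule field_C)
  have "value_of \<zero>\<^bsub>C\<^esub> = value_of \<zero>\<^bsub>C\<^esub> + value_of \<zero>\<^bsub>C\<^esub>"
    using value_of_simps(1)[OF C.zero_closed C.zero_closed] unfolding C.l_zero[OF C.zero_closed] .
  then show ?thesis by linarith
qed

lemma value_of_uminus:
  assumes "F \<in> carrier C"
  shows "value_of (\<ominus>\<^bsub>C\<^esub> F) = - value_of F"
proof -
  interpret C: field C by (rule field_C)
  have "value_of (F \<oplus>\<^bsub>C\<^esub> \<ominus>\<^bsub>C\<^esub> F) = 0"
    unfolding C.r_neg[OF assms] by (rule value_of_zero)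
  then show ?thesis
    unfolding value_of_simps(1)[OF assms C.a_inv_closed[OF assms]] by linarith
qed

lemma value_of_minus:
  assumes "F \<in> carrier C" "G \<in> carrier C"
  shows "value_of (F \<ominus>\<^bsub>C\<^esub> G) = value_of F - value_of G"
proof -
  interpret C: field C by (rule field_C)
  show ?thesis
    unfolding a_minus_def value_of_simps(1)[OF assms(1) C.a_inv_closed[OF assms(2)]]
      value_of_uminus[OF assms(2)] by simp
qed

lemma value_of_inv:
  assumes "F \<in> carrier C - {\<zero>\<^bsub>C\<^esub>}"
  shows "inv\<^bsub>C\<^esub> F \<in> carrier C" "value_of (inv\<^bsub>C\<^esub> F) = inverse (value_of F)"
proof -
  interpret C: field C by (rule field_C)
  have u: "F \<in> Units C" using assms C.field_Units by simp
  show inv: "inv\<^bsub>C\<^esub> F \<in> carrier C" using u by (rule C.Units_inv_closed)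
  have "value_of (F \<otimes>\<^bsub>C\<^esub> inv\<^bsub>C\<^esub> F) = 1"
    using u ring_iso_memE(4)[OF value_of_iso] by simp
  then have "value_of F * value_of (inv\<^bsub>C\<^esub> F) = 1" using value_of_simps(2) inv assms by simp
  then show "value_of (inv\<^bsub>C\<^esub> F) = inverse (value_of F)" by (rule inverse_unique[symmetric])
qed

lemma carrier_CD:
  assumes "F \<in> carrier C"
  shows "F \<noteq> {}" "F \<subseteq> carrier R" "f \<in> F \<Longrightarrow> seq_value f = value_of F"
proof -
  interpret h: ring_hom_ring R real_ring seq_value by (rule seq_value_hom)
  have F: "F \<in> carrier (R Quot a_kernel R real_ring seq_value)"
    using assms by (simp add: theta_completion_def null_ideal_eq)
  from h.the_elem_wf[OF F] obtain y where y: "seq_value ` F = {y}" by blast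
  then show "F \<noteq> {}" by auto
  show "F \<subseteq> carrier R"
    using F ideal.Icarr[OF h.kernel_is_ideal]
    by (auto simp: FactRing_def A_RCOSETS_def' a_r_coset_def' R_closed)
  show "seq_value f = value_of F" if "f \<in> F" for f
    using y that by (auto simp: value_of_def)
qed

lemma embedding:
  assumes "\<alpha> \<in> quad_ints"
  shows "completion_embedding \<theta> a \<alpha> \<in> carrier C"
    "value_of (completion_embedding \<theta> a \<alpha>) = galois \<alpha>"
proof -
  interpret R: cring R by (rule cring_R)
  interpret h: ring_hom_ring R real_ring seq_value by (rule seq_value_hom)
  show F: "completion_embedding \<theta> a \<alpha> \<in> carrier C"
    using R_const(1)[OF assms]
    by (auto simp: completion_embedding_def theta_completion_def FactRing_def A_RCOSETS_def')
  have "(\<lambda>_. 0) \<in> null_ideal \<theta> a"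
    unfolding null_ideal_def by (simp add: theta_abs_def R_consts)
  then have "(\<lambda>_. \<alpha>) \<in> completion_embedding \<theta> a \<alpha>"
    unfolding completion_embedding_def a_r_coset_def' by force
  from carrier_CD(3)[OF F this] show "value_of (completion_embedding \<theta> a \<alpha>) = galois \<alpha>"
    by (simp add: R_const(2)[OF assms])
qed

end

section \<open>The inframetric topology\<close>

lemma limsup_between:
  fixes u :: "nat \<Rightarrow> real"
  assumes "v \<longlonglongrightarrow> l" "w \<longlonglongrightarrow> r" "\<And>n. v n \<le> u n" "\<And>n. u n \<le> w n"
  shows "ereal l \<le> limsup (\<lambda>n. ereal (u n))" "limsup (\<lambda>n. ereal (u n)) \<le> ereal r"
proof -
  have "limsup (\<lambda>n. ereal (v n)) = ereal l" "limsup (\<lambda>n. ereal (w n)) = ereal r"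
    using assms(1,2) by (intro lim_imp_Limsup; simp)+
  moreover have "limsup (\<lambda>n. ereal (v n)) \<le> limsup (\<lambda>n. ereal (u n))"
    "limsup (\<lambda>n. ereal (u n)) \<le> limsup (\<lambda>n. ereal (w n))"
    using assms(3,4) by (intro Limsup_mono; simp)+
  ultimately show "ereal l \<le> limsup (\<lambda>n. ereal (u n))" "limsup (\<lambda>n. ereal (u n)) \<le> ereal r"
    by auto
qed

text \<open>The limsup is a limit along a subsequence, and finite sets are closed.\<close>

lemma limsup_in_finite:
  fixes u :: "nat \<Rightarrow> 'a :: {complete_linorder, linorder_topology}"
  assumes "finite S" "eventually (\<lambda>n. u n \<in> S) sequentially"
  shows "limsup u \<in> S"
proof -
  obtain r :: "nat \<Rightarrow> nat" where r: "strict_mono r" "(u \<circ> r) \<longlonglongrightarrow> limsup u"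
    using limsup_subseq_lim by blast
  have "eventually (\<lambda>n. (u \<circ> r) n \<in> S) sequentially"
    using eventually_subseq[OF r(1) assms(2)] by simp
  then show ?thesis
    using Lim_in_closed_set[OF finite_imp_closed[OF assms(1)] _ _ r(2)] by simp
qed

text \<open>Neighbourhood filters determine a topology: a set is open iff it is a neighbourhood of
  each of its points.\<close>

lemma is_inframetric_topology_unique:
  assumes "is_inframetric_topology \<theta> a T" "is_inframetric_topology \<theta> a T'"
  shows "T = T'"
proof -
  have le: "openin T2 U"
    if T: "is_inframetric_topology \<theta> a T1" "is_inframetric_topology \<theta> a T2" and U: "openin T1 U"
    for T1 T2 U
  proof (subst openin_subopen, intro ballI)
    fix F assume "F \<in> U"
    then have F: "F \<in> carrier (theta_completion \<theta> a)"
      using openin_subset[OF U] T(1) by (auto simp: is_inframetric_topology_def)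
    have "eventually (\<lambda>G. G \<in> U) (nhdsin T1 F)"
      using U \<open>F \<in> U\<close> by (auto simp: eventually_nhdsin)
    then have "eventually (\<lambda>G. G \<in> U) (nhdsin T2 F)"
      using T F by (simp add: is_inframetric_topology_def)
    then show "\<exists>V. openin T2 V \<and> F \<in> V \<and> V \<subseteq> U"
      using T(2) F by (auto simp: eventually_nhdsin is_inframetric_topology_def)
  qed
  show ?thesis
    unfolding topology_eq using le[OF assms] le[OF assms(2,1)] by blast
qed

context quadratic_unit
begin

lemma finite_theta_powers:
  assumes "B > 0"
  shows "finite {x. \<exists>k. x = \<theta> powi k \<and> B \<le> x \<and> x \<le> D}"
proof -
  obtain n where n: "D < \<theta> ^ n" using real_arch_pow[OF gt_1] by blast
  obtain m where m: "inverse B < \<theta> ^ m" using real_arch_pow[OF gt_1] by blast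
  have m': "\<theta> powi (- int m) < B"
    using m assms gt_1 by (simp add: power_int_minus field_simps)
  have "{x. \<exists>k. x = \<theta> powi k \<and> B \<le> x \<and> x \<le> D} \<subseteq> (\<lambda>k. \<theta> powi k) ` {- int m..int n}"
  proof clarify
    fix k assume k: "B \<le> \<theta> powi k" "\<theta> powi k \<le> D"
    have "k \<le> int n"
    proof (rule ccontr)
      assume "\<not> k \<le> int n"
      then have "\<theta> powi int n \<le> \<theta> powi k" using gt_1 by (intro power_int_increasing) auto
      then show False using k n by simp
    qed
    moreover have "- int m \<le> k"
    proof (rule ccontr)
      assume "\<not> - int m \<le> k"
      then have "\<theta> powi k \<le> \<theta> powi (- int m)" using gt_1 by (intro power_int_increasing) auto
      then show False using k m' by simp
    qed
    ultimately show "\<theta> powi k \<in> (\<lambda>k. \<theta> powi k) ` {- int m..int n}" by simp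
  qed
  then show ?thesis by (rule finite_subset) simp
qed

end

context greedy_quadratic_unit
begin

lemma limsup_theta_abs_bounds:
  assumes "F \<in> carrier C" "h \<in> F"
  shows "ereal (inverse \<theta> * \<bar>value_of F\<bar>) \<le> limsup (\<lambda>i. ereal (theta_abs \<theta> a (h i)))"
    "limsup (\<lambda>i. ereal (theta_abs \<theta> a (h i))) \<le> ereal (\<theta> * \<bar>value_of F\<bar>)"
proof -
  have h: "h \<in> carrier R" using carrier_CD(2) assms by blast
  have "(\<lambda>i. \<bar>galois (h i)\<bar>) \<longlonglongrightarrow> \<bar>value_of F\<bar>"
    using tendsto_rabs[OF carrier_RD(3)[OF h]] carrier_CD(3)[OF assms] by simp
  then have lim: "(\<lambda>i. c * \<bar>galois (h i)\<bar>) \<longlonglongrightarrow> c * \<bar>value_of F\<bar>" for c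
    by (rule tendsto_mult_left)
  have le: "inverse \<theta> * \<bar>galois (h i)\<bar> \<le> theta_abs \<theta> a (h i)" for i
    using theta_abs_bounds(2)[OF carrier_RD(1)[OF h, of i]] gt_1 by (simp add: field_simps)
  show "ereal (inverse \<theta> * \<bar>value_of F\<bar>) \<le> limsup (\<lambda>i. ereal (theta_abs \<theta> a (h i)))"
    "limsup (\<lambda>i. ereal (theta_abs \<theta> a (h i))) \<le> ereal (\<theta> * \<bar>value_of F\<bar>)"
    by (rule limsup_between[OF lim lim le theta_abs_bounds(3)[OF carrier_RD(1)[OF h]]])+
qed

text \<open>At value 0 the two-sided estimate leaves only the limsup 0. Otherwise the terms of a
  representing sequence are eventually powers of \<open>\<theta>\<close> in a range that depends on
  \<open>F\<close> alone and stays away from 0, so all the limsups lie in one finite set.\<close>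

lemma finite_limsups:
  assumes "F \<in> carrier C"
  shows "finite {r. \<exists>h\<in>F. r = limsup (\<lambda>i. ereal (theta_abs \<theta> a (h i)))}" (is "finite ?L")
proof (cases "value_of F = 0")
  case True
  then have "?L \<subseteq> {0}"
    using limsup_theta_abs_bounds[OF assms] by (force simp: zero_ereal_def)
  then show ?thesis by (rule finite_subset) simp
next
  case False
  define v where "v = \<bar>value_of F\<bar>"
  have v: "v > 0" using False by (simp add: v_def)
  \<comment> \<open>The conjugates eventually lie between \<open>v / 2\<close> and
    \<open>2 * v\<close>; the outer factors are the loss in comparing them with
    \<open>theta_abs\<close>.\<close>
  define S where "S = {x. \<exists>k. x = \<theta> powi k \<and> inverse \<theta> * (v / 2) \<le> x \<and> x \<le> \<theta> * (2 * v)}"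
  have S: "finite S" unfolding S_def using v gt_1 by (intro finite_theta_powers) simp
  have "limsup (\<lambda>i. ereal (theta_abs \<theta> a (h i))) \<in> ereal ` S" if h: "h \<in> F" for h
  proof (rule limsup_in_finite)
    have R: "h \<in> carrier R" using carrier_CD(2) assms h by blast
    have lim: "(\<lambda>i. \<bar>galois (h i)\<bar>) \<longlonglongrightarrow> v"
      using tendsto_rabs[OF carrier_RD(3)[OF R]] carrier_CD(3)[OF assms h] by (simp add: v_def)
    have "eventually (\<lambda>i. v / 2 < \<bar>galois (h i)\<bar> \<and> \<bar>galois (h i)\<bar> < 2 * v) sequentially"
      using order_tendstoD(1)[OF lim, of "v / 2"] order_tendstoD(2)[OF lim, of "2 * v"] v
      by (intro eventually_conj) simp_all
    then show "eventually (\<lambda>i. ereal (theta_abs \<theta> a (h i)) \<in> ereal ` S) sequentially"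
    proof eventually_elim
      case (elim i)
      have "h i \<noteq> 0" using elim v by auto
      obtain k where k: "theta_abs \<theta> a (h i) = \<theta> powi k"
          "\<bar>galois (h i)\<bar> \<le> \<theta> * \<theta> powi k" "\<theta> powi k \<le> \<theta> * \<bar>galois (h i)\<bar>"
        using theta_abs_cases[OF carrier_RD(1)[OF R] \<open>h i \<noteq> 0\<close>] .
      have "v / 2 \<le> \<theta> * \<theta> powi k" using elim k(2) by simp
      then have "inverse \<theta> * (v / 2) \<le> \<theta> powi k" using gt_1 by (simp add: field_simps)
      moreover have "\<theta> * \<bar>galois (h i)\<bar> \<le> \<theta> * (2 * v)" using elim gt_1 by simp
      ultimately show ?case using k(1,3) by (auto simp: S_def)
    qed
  qed (use S in simp)
  then have "?L \<subseteq> ereal ` S" by blast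
  then show ?thesis by (rule finite_subset) (use S in simp)
qed

text \<open>\<open>GREATEST\<close> says nothing unless a maximum is attained. Finiteness makes it a
  \<open>Max\<close>, hence the limsup of some actual representing sequence, to which the estimates
  apply.\<close>

lemma completion_abs_bounds:
  assumes "F \<in> carrier C"
  shows "ereal (inverse \<theta> * \<bar>value_of F\<bar>) \<le> completion_abs \<theta> a F"
    "completion_abs \<theta> a F \<le> ereal (\<theta> * \<bar>value_of F\<bar>)"
proof -
  let ?P = "\<lambda>r. \<exists>h\<in>F. r = limsup (\<lambda>i. ereal (theta_abs \<theta> a (h i)))"
  have fin: "finite {r. ?P r}" by (rule finite_limsups[OF assms])
  have ne: "{r. ?P r} \<noteq> {}" using carrier_CD(1)[OF assms] by auto
  have "completion_abs \<theta> a F = Max {r. ?P r}"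
    unfolding completion_abs_def
    by (rule Greatest_equality) (use Max_in[OF fin ne] Max_ge[OF fin] in auto)
  then obtain h where "h \<in> F" "completion_abs \<theta> a F = limsup (\<lambda>i. ereal (theta_abs \<theta> a (h i)))"
    using Max_in[OF fin ne] by auto
  then show "ereal (inverse \<theta> * \<bar>value_of F\<bar>) \<le> completion_abs \<theta> a F"
    "completion_abs \<theta> a F \<le> ereal (\<theta> * \<bar>value_of F\<bar>)"
    using limsup_theta_abs_bounds[OF assms] by auto
qed

section \<open>Inframetric balls between preimages of intervals\<close>

lemma completion_ball_subset:
  assumes "F \<in> carrier C" "G \<in> completion_ball \<theta> a F \<epsilon>"
  shows "G \<in> carrier C" "\<bar>value_of F - value_of G\<bar> < \<theta> * \<epsilon>"
proof -
  interpret C: field C by (rule field_C)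
  show G: "G \<in> carrier C" using assms by (simp add: completion_ball_def)
  have "ereal (inverse \<theta> * \<bar>value_of F - value_of G\<bar>) \<le> completion_abs \<theta> a (F \<ominus>\<^bsub>C\<^esub> G)"
    using completion_abs_bounds(1)[of "F \<ominus>\<^bsub>C\<^esub> G"] assms(1) G by (simp add: value_of_minus)
  also have "\<dots> < ereal \<epsilon>" using assms by (simp add: completion_ball_def)
  finally show "\<bar>value_of F - value_of G\<bar> < \<theta> * \<epsilon>" using gt_1 by (simp add: field_simps)
qed

lemma in_completion_ball:
  assumes "F \<in> carrier C" "G \<in> carrier C" "\<theta> * \<bar>value_of F - value_of G\<bar> < \<epsilon>"
  shows "G \<in> completion_ball \<theta> a F \<epsilon>"
proof -
  interpret C: field C by (rule field_C)
  have "completion_abs \<theta> a (F \<ominus>\<^bsub>C\<^esub> G) \<le> ereal (\<theta> * \<bar>value_of F - value_of G\<bar>)"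
    using completion_abs_bounds(2)[of "F \<ominus>\<^bsub>C\<^esub> G"] assms(1,2) by (simp add: value_of_minus)
  also have "\<dots> < ereal \<epsilon>" using assms(3) by simp
  finally show ?thesis using assms(2) by (simp add: completion_ball_def)
qed

abbreviation value_topology where
  "value_topology \<equiv> pullback_topology (carrier C) value_of euclideanreal"

text \<open>Each ball around \<open>F\<close> lies between the preimages of two intervals around
  \<open>value_of F\<close>, with radii \<open>\<epsilon> / \<theta>\<close> and
  \<open>\<theta> * \<epsilon>\<close>. So both kinds of set generate the same neighbourhood filter,
  whether or not the balls are open.\<close>

lemma is_inframetric_value_topology: "is_inframetric_topology \<theta> a value_topology"
proof -
  have top: "topspace value_topology = carrier C" by (simp add: topspace_pullback_topology)
  have "eventually P (nhdsin value_topology F) \<longleftrightarrow> (\<exists>\<epsilon>>0. \<forall>G\<in>completion_ball \<theta> a F \<epsilon>. P G)"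
    if F: "F \<in> carrier C" for F P
  proof
    assume "eventually P (nhdsin value_topology F)"
    then obtain U where U: "open U" "value_of F \<in> U" "\<And>G. G \<in> carrier C \<Longrightarrow> value_of G \<in> U \<Longrightarrow> P G"
      using F by (auto simp: eventually_nhdsin top openin_pullback_topology)
    then obtain \<delta> where \<delta>: "\<delta> > 0" "\<And>y. dist y (value_of F) < \<delta> \<Longrightarrow> y \<in> U"
      by (auto simp: open_dist)
    have "P G" if "G \<in> completion_ball \<theta> a F (\<delta> / \<theta>)" for G
      using completion_ball_subset[OF F that] gt_1
      by (intro U(3) \<delta>(2)) (auto simp: dist_real_def abs_minus_commute)
    then show "\<exists>\<epsilon>>0. \<forall>G\<in>completion_ball \<theta> a F \<epsilon>. P G"
      using \<delta>(1) gt_1 by (intro exI[of _ "\<delta> / \<theta>"]) auto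
  next
    assume "\<exists>\<epsilon>>0. \<forall>G\<in>completion_ball \<theta> a F \<epsilon>. P G"
    then obtain \<epsilon> where \<epsilon>: "\<epsilon> > 0" "\<And>G. G \<in> completion_ball \<theta> a F \<epsilon> \<Longrightarrow> P G" by blast
    let ?U = "ball (value_of F) (\<epsilon> / \<theta>)"
    have "P G" if "G \<in> carrier C" "value_of G \<in> ?U" for G
      using that gt_1 by (intro \<epsilon>(2) in_completion_ball F) (auto simp: dist_real_def field_simps)
    moreover have "openin value_topology (value_of -` ?U \<inter> carrier C)"
      unfolding openin_pullback_topology by (metis open_openin open_ball)
    ultimately show "eventually P (nhdsin value_topology F)"
      unfolding eventually_nhdsin using F \<epsilon>(1) gt_1
      by (intro disjI2 exI[of _ "value_of -` ?U \<inter> carrier C"]) auto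
  qed
  then show ?thesis using top by (simp add: is_inframetric_topology_def)
qed

lemma inframetric_topology_eq: "inframetric_topology \<theta> a = value_topology"
  unfolding inframetric_topology_def
  using is_inframetric_value_topology is_inframetric_topology_unique by (blast intro: the_equality)

lemma topological_field_completion: "topological_field C (inframetric_topology \<theta> a)"
proof -
  interpret C: field C by (rule field_C)
  let ?T = value_topology
  have top [simp]: "topspace ?T = carrier C" by (simp add: topspace_pullback_topology)
  have val: "continuous_map ?T euclideanreal value_of"
    using continuous_map_pullback[of euclideanreal euclideanreal id] by (simp add: continuous_map_id)
  \<comment> \<open>Universal property of the pullback topology: continuity into the completion is
    continuity of the real values, so each field operation reduces to the one on the reals.\<close>
  have into: "continuous_map T ?T g"
    if "continuous_map T euclideanreal w"
      "\<And>x. x \<in> topspace T \<Longrightarrow> g x \<in> carrier C \<and> value_of (g x) = w x" for T :: "'z topology" and g w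
  proof (rule continuous_map_pullback')
    show "continuous_map T euclideanreal (value_of \<circ> g)"
      by (rule continuous_map_eq[OF that(1)]) (use that(2) in simp)
    show "topspace T \<subseteq> g -` carrier C" using that(2) by blast
  qed
  have fst: "continuous_map (prod_topology ?T ?T) euclideanreal (\<lambda>z. value_of (fst z))"
    using continuous_map_compose[OF continuous_map_fst val] by (simp add: comp_def)
  have snd: "continuous_map (prod_topology ?T ?T) euclideanreal (\<lambda>z. value_of (snd z))"
    using continuous_map_compose[OF continuous_map_snd val] by (simp add: comp_def)
  have "continuous_map (prod_topology ?T ?T) ?T (\<lambda>(x, y). x \<oplus>\<^bsub>C\<^esub> y)"
    by (rule into[OF continuous_map_add[OF fst snd]]) (auto simp: value_of_simps)
  moreover have "continuous_map (prod_topology ?T ?T) ?T (\<lambda>(x, y). x \<otimes>\<^bsub>C\<^esub> y)"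
    by (rule into[OF continuous_map_real_mult[OF fst snd]]) (auto simp: value_of_simps)
  moreover have "continuous_map ?T ?T (\<lambda>x. \<ominus>\<^bsub>C\<^esub> x)"
    by (rule into[OF continuous_map_minus[OF val]]) (auto simp: value_of_uminus)
  moreover have "continuous_map (subtopology ?T (carrier C - {\<zero>\<^bsub>C\<^esub>})) ?T (\<lambda>x. inv\<^bsub>C\<^esub> x)"
  proof (rule into[OF continuous_map_real_inverse[OF continuous_map_from_subtopology[OF val]]])
    fix x assume x: "x \<in> topspace (subtopology ?T (carrier C - {\<zero>\<^bsub>C\<^esub>}))"
    then show "value_of x \<noteq> 0"
      using value_of_eq_iff[of x "\<zero>\<^bsub>C\<^esub>"] by (auto simp: value_of_zero)
    from x show "inv\<^bsub>C\<^esub> x \<in> carrier C \<and> value_of (inv\<^bsub>C\<^esub> x) = inverse (value_of x)"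
      using value_of_inv[of x] by auto
  qed
  ultimately show ?thesis
    unfolding topological_field_def inframetric_topology_eq using field_C top by blast
qed

lemma number_field_embedding:
  "\<exists>\<phi>. \<phi> \<in> ring_hom (real_ring\<lparr>carrier := number_field \<theta>\<rparr>) C \<and> inj_on \<phi> (number_field \<theta>) \<and>
     (\<forall>\<alpha>\<in>integer_ring \<theta>. \<phi> \<alpha> = completion_embedding \<theta> a \<alpha>)"
proof -
  \<comment> \<open>Pull the conjugate back along \<open>value_of\<close>. On an integer this yields
    the class of the constant sequence, because that class has the same real value.\<close>
  define \<phi> where "\<phi> x = inv_into (carrier C) value_of (galois x)" for x
  have h: "inv_into (carrier C) value_of \<in> ring_iso real_ring C"
    by (rule ring_iso_set_sym[OF ring_C value_of_iso])
  have "\<phi> \<in> ring_hom (real_ring\<lparr>carrier := number_field \<theta>\<rparr>) C"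
    unfolding number_field_eq
    using ring_iso_memE[OF h]
    by (intro ring_hom_memI) (auto simp: \<phi>_def galois_mult(2) galois_add(2))
  moreover have "inj_on \<phi> (number_field \<theta>)"
  proof -
    have "inj_on (inv_into (carrier C) value_of) UNIV"
      using ring_iso_memE(5)[OF h] by (simp add: bij_betw_def)
    then show ?thesis
      using inj_on_galois unfolding \<phi>_def[abs_def] number_field_eq by (auto simp: inj_on_def)
  qed
  moreover have "\<phi> \<alpha> = completion_embedding \<theta> a \<alpha>" if "\<alpha> \<in> integer_ring \<theta>" for \<alpha>
    using embedding[of \<alpha>] that bij_value_of inv_into_f_f[of value_of "carrier C"]
    by (metis \<phi>_def integer_ring_eq bij_betw_imp_inj_on)
  ultimately show ?thesis by blast
qed

end

theorem theorem29:
  fixes \<theta> :: real and a :: int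
  assumes "\<theta> > 1" and "\<theta> \<notin> \<rat>"
    and "a \<ge> 1" and "\<theta>\<^sup>2 = of_int a * \<theta> + 1"
    and greedy: "\<forall>\<alpha>\<in>integer_ring \<theta>. \<alpha> \<noteq> 0 \<longrightarrow> (\<exists>m. greedy_order \<theta> a \<alpha> m)"
  shows "topological_field (theta_completion \<theta> a) (inframetric_topology \<theta> a) \<and>
    (\<exists>\<phi>. \<phi> \<in> ring_hom (real_ring\<lparr>carrier := number_field \<theta>\<rparr>) (theta_completion \<theta> a) \<and>
         inj_on \<phi> (number_field \<theta>) \<and>
         (\<forall>\<alpha>\<in>integer_ring \<theta>. \<phi> \<alpha> = completion_embedding \<theta> a \<alpha>))"
proof -
  interpret greedy_quadratic_unit \<theta> a
    using assms by unfold_locales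
  show ?thesis using topological_field_completion number_field_embedding by blast
qed

end
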